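(* Fix $\varepsilon>0$. The function $\Phi_\varepsilon^G:\mathbb{R}^{K\times N}\to\mathbb{R}$ is concave. Moreover, for each $i\in[N]$ and each $\boldsymbol\theta\in\mathbb{R}^{K\times N}$, \[ \nabla_{\theta_i}\Phi_\varepsilon^G(\boldsymbol\theta)=-\frac{1}{\varepsilon|\Omega|}\sum_{x\in\Omega}\Big(\delta_{iG(x)}-(p_{\boldsymbol\theta}^{\varepsilon})_i(x)\Big)\,\eta(x). \] Similarly, for $i,k\in[N]$, the $(i,k)$-block of the Hessian is \[ \nabla_{\theta_k}\nabla_{\theta_i}\Phi_\varepsilon^G(\boldsymbol\theta)=-\frac{1}{\varepsilon^2|\Omega|}\sum_{x\in\Omega}(p_{\boldsymbol\theta}^{\varepsilon})_i(x)\big(\delta_{ik}-(p_{\boldsymbol\theta}^{\varepsilon})_k(x)\big)\,\bigl(\eta(x)\otimes\eta(x)\bigr), \] and the Hessian is negative semidefinite, with every vector of the form $(c,\dots,c)\in\mathbb{R}^{K\times N}$, $c\in\mathbb{R}^K$, lying in its nullspace.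
   Context: Let $\overline\Omega=[-1,1]^2$ and let $\Omega\subset\overline\Omega$ be a nonempty finite set (of pixels). Let $N>1$ and $K\ge 1$ be integers and $[N]:=\{1,\dots,N\}$. Let $G:\Omega\to[N]$ be a given map (the grain map) and $\eta:\overline\Omega\to\mathbb{R}^K$ a given function (the design function). For $\boldsymbol\theta=(\theta_1,\dots,\theta_N)\in\mathbb{R}^{K\times N}$ with $\theta_i\in\mathbb{R}^K$, set $h_{\theta_i}(x):=\theta_i\cdot\eta(x)$ for $x\in\overline\Omega$. Soft assignment, for $\varepsilon>0$: \[ (p_{\boldsymbol\theta}^\varepsilon)_i(x):=\frac{\exp\left(-\frac1\varepsilon h_{\theta_i}(x)\right)}{\sum_{j=1}^N\exp\left(-\frac1\varepsilon h_{\theta_j}(x)\right)},\qquad i\in[N]. \] Objective function, for $\varepsilon>0$: \[ \Phi_\varepsilon^G(\boldsymbol\theta):=\frac{1}{|\Omega|}\sum_{x\in\Omega}\log\big((p_{\boldsymbol\theta}^\varepsilon)_{G(x)}(x)\big). \] Here $\delta$ is the Kronecker delta, $\nabla_{\theta_i}$ is the gradient with respect to the block $\theta_i\in\mathbb{R}^K$, and $u\otimes u=uu^\top\in\mathbb{R}^{K\times K}$. *)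

theory Defs
  imports "HOL-Analysis.Analysis"
begin

text \<open>
  The index set \<open>[N]\<close> is the finite type \<open>'n\<close> (so \<open>N = CARD('n)\<close>) and \<open>\<real>\<^sup>K\<close> is \<open>real ^ 'k\<close>.
  A parameter \<open>\<theta> \<in> \<real>\<^sup>K\<^sup>\<times>\<^sup>N\<close> is stored by its columns: \<open>\<theta> :: (real ^ 'k) ^ 'n\<close> and
  \<open>\<theta> $ i\<close> is the block \<open>\<theta>\<^sub>i\<close>.  The inner product of this type is the Frobenius one.
  Functions with domain the square or the pixel set are total in HOL; their values
  outside that domain are never used.
\<close>

definition Omega_bar :: "(real \<times> real) set" where
  "Omega_bar = {-1..1} \<times> {-1..1}"

definition h :: "(real \<times> real \<Rightarrow> real ^ 'k) \<Rightarrow> real ^ 'k \<Rightarrow> real \<times> real \<Rightarrow> real" where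
  "h \<eta> \<theta>i x = \<theta>i \<bullet> \<eta> x"

definition soft_assign ::
  "(real \<times> real \<Rightarrow> real ^ 'k) \<Rightarrow> real \<Rightarrow> (real ^ 'k) ^ 'n \<Rightarrow> 'n \<Rightarrow> real \<times> real \<Rightarrow> real" where
  "soft_assign \<eta> \<epsilon> \<theta> i x =
     exp (- (1 / \<epsilon>) * h \<eta> (\<theta> $ i) x) / (\<Sum>j\<in>UNIV. exp (- (1 / \<epsilon>) * h \<eta> (\<theta> $ j) x))"

definition objective ::
  "(real \<times> real) set \<Rightarrow> (real \<times> real \<Rightarrow> 'n) \<Rightarrow> (real \<times> real \<Rightarrow> real ^ 'k) \<Rightarrow> real
     \<Rightarrow> (real ^ 'k) ^ 'n \<Rightarrow> real" where
  "objective \<Omega> G \<eta> \<epsilon> \<theta> =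
     1 / real (card \<Omega>) * (\<Sum>x\<in>\<Omega>. ln (soft_assign \<eta> \<epsilon> \<theta> (G x) x))"

definition kronecker :: "'n \<Rightarrow> 'n \<Rightarrow> real" where
  "kronecker i j = (if i = j then 1 else 0)"

definition outer :: "real ^ 'k \<Rightarrow> real ^ 'k \<Rightarrow> real ^ 'k ^ 'k" where
  "outer u v = (\<chi> a b. u $ a * v $ b)"

definition block_upd :: "'a ^ 'n \<Rightarrow> 'n \<Rightarrow> 'a \<Rightarrow> 'a ^ 'n" where
  "block_upd \<theta> i t = (\<chi> j. if j = i then t else \<theta> $ j)"

text \<open>Only meaningful where \<open>f\<close> is differentiable.\<close>

definition gradient :: "('a::real_inner \<Rightarrow> real) \<Rightarrow> 'a \<Rightarrow> 'a" where
  "gradient f x = (THE D. GDERIV f x :> D)"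

definition has_block_gradient ::
  "((real ^ 'k) ^ 'n \<Rightarrow> real) \<Rightarrow> 'n \<Rightarrow> (real ^ 'k) ^ 'n \<Rightarrow> real ^ 'k \<Rightarrow> bool" where
  "has_block_gradient f i \<theta> D \<longleftrightarrow> (GDERIV (\<lambda>t. f (block_upd \<theta> i t)) (\<theta> $ i) :> D)"

definition block_gradient ::
  "((real ^ 'k) ^ 'n \<Rightarrow> real) \<Rightarrow> 'n \<Rightarrow> (real ^ 'k) ^ 'n \<Rightarrow> real ^ 'k" where
  "block_gradient f i \<theta> = gradient (\<lambda>t. f (block_upd \<theta> i t)) (\<theta> $ i)"

text \<open>
  \<open>M\<close> is the Jacobian matrix of the vector field \<open>F\<close> with respect to the block \<open>\<theta>\<^sub>k\<close>, so that
  \<open>has_block_jacobian (block_gradient f i) k \<theta> M\<close> reads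
  \<open>\<nabla>\<^bsub>\<theta>k\<^esub>\<nabla>\<^bsub>\<theta>i\<^esub> f(\<theta>) = M\<close>, including existence of the derivative.
\<close>

definition has_block_jacobian ::
  "((real ^ 'k) ^ 'n \<Rightarrow> real ^ 'k) \<Rightarrow> 'n \<Rightarrow> (real ^ 'k) ^ 'n \<Rightarrow> real ^ 'k ^ 'k \<Rightarrow> bool" where
  "has_block_jacobian F k \<theta> M \<longleftrightarrow>
     ((\<lambda>t. F (block_upd \<theta> k t)) has_derivative (\<lambda>v. M *v v)) (at (\<theta> $ k))"

text \<open>
  The full Hessian as a linear operator on the parameter space: the derivative of the full
  gradient.  Its \<open>(i,k)\<close>-block maps a perturbation of \<open>\<theta>\<^sub>k\<close> to the change of the \<open>i\<close>-th block
  of the gradient.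
\<close>

definition twice_differentiable_at :: "('a::real_inner \<Rightarrow> real) \<Rightarrow> 'a \<Rightarrow> bool" where
  "twice_differentiable_at f x \<longleftrightarrow>
     (\<forall>\<^sub>F y in nhds x. f differentiable (at y)) \<and> gradient f differentiable (at x)"

definition hessian :: "('a::real_inner \<Rightarrow> real) \<Rightarrow> 'a \<Rightarrow> 'a \<Rightarrow> 'a" where
  "hessian f x = frechet_derivative (gradient f) (at x)"

definition operator_block ::
  "((real ^ 'k) ^ 'n \<Rightarrow> (real ^ 'k) ^ 'n) \<Rightarrow> 'n \<Rightarrow> 'n \<Rightarrow> real ^ 'k ^ 'k" where
  "operator_block H i k = matrix (\<lambda>v. H (block_upd 0 k v) $ i)"

definition negative_semidefinite :: "('a::real_inner \<Rightarrow> 'a) \<Rightarrow> bool" where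
  "negative_semidefinite H \<longleftrightarrow>
     linear H \<and> (\<forall>u v. H u \<bullet> v = u \<bullet> H v) \<and> (\<forall>v. v \<bullet> H v \<le> 0)"

end

theory Submission
  imports Defs
begin

text \<open>
  At a single pixel the objective is, up to an affine term, minus a log-sum-exp function, and
  everything follows from one derivative, that of \<open>ln p\<^sub>i\<close> (\<open>has_derivative_ln_soft_assign\<close>):
  in direction \<open>v\<close> it is \<open>-1/\<epsilon>\<close> times the deviation of the score \<open>v\<^sub>i \<bullet> \<eta>\<close> from its mean under
  the weights \<open>p\<close>.  Summing over the pixels gives the gradient.  Since \<open>p\<^sub>i = exp (ln p\<^sub>i)\<close>, the
  same formula multiplied by \<open>p\<^sub>i\<close> is the derivative of \<open>p\<^sub>i\<close>, and this gives the Hessian.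

  The bilinear form of the Hessian is therefore \<open>-1/(\<epsilon>\<^sup>2 |\<Omega>|)\<close> times a sum over the pixels of
  covariances under \<open>p\<close> of the scores \<open>u\<^sub>i \<bullet> \<eta>\<close> and \<open>v\<^sub>i \<bullet> \<eta>\<close> (\<open>inner_objective_hessian\<close>).
  A covariance is symmetric, and a variance is nonnegative, which makes the Hessian negative
  semidefinite; a constant has no deviation from its mean, which puts \<open>(c, \<dots>, c)\<close> in the
  nullspace.  Concavity is the negative semidefiniteness, read along line segments
  (\<open>concave_on_UNIV_if_hessian_nonpos\<close>).

  The blocks of gradient and Hessian are obtained by restricting the full derivatives to the
  directions \<open>axis k v\<close>.
\<close>

section \<open>Derivatives of vector-valued functions and of functions of one block\<close>

lemma has_derivative_vec_lambda:
  fixes f :: "'i::finite \<Rightarrow> 'a::real_normed_vector \<Rightarrow> 'b::real_normed_vector"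
  assumes "\<And>i. (f i has_derivative f' i) F"
  shows "((\<lambda>x. \<chi> i. f i x) has_derivative (\<lambda>v. \<chi> i. f' i v)) F"
proof -
  have expand: "(\<chi> i. y i) = (\<Sum>i\<in>UNIV. axis i (y i))" for y :: "'i \<Rightarrow> 'b"
    by (simp add: vec_eq_iff axis_def)
  have "bounded_linear (axis i :: 'b \<Rightarrow> 'b ^ 'i)" for i
  proof (rule bounded_linear_intro[where K = 1])
    show "norm (axis i x :: 'b ^ 'i) \<le> norm x * 1" for x
      by (simp add: norm_vec_def L2_set_def axis_def if_distrib[of norm]
          if_distrib[of "\<lambda>r. r\<^sup>2"] cong: if_cong)
  qed (auto simp: vec_eq_iff axis_def)
  then show ?thesis
    unfolding expand
    by (intro has_derivative_sum) (rule bounded_linear.has_derivative[OF _ assms])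
qed

lemma has_derivative_block_upd:
  fixes \<theta> :: "'a::real_normed_vector ^ 'n::finite"
  shows "(block_upd \<theta> k has_derivative axis k) (at t)"
proof -
  have "((\<lambda>t. \<chi> j. if j = k then t else \<theta> $ j) has_derivative
      (\<lambda>v. \<chi> j. if j = k then v else 0)) (at t)"
  proof (rule has_derivative_vec_lambda)
    show "((\<lambda>t. if j = k then t else \<theta> $ j) has_derivative (\<lambda>v. if j = k then v else 0)) (at t)"
      for j
      by (cases "j = k") auto
  qed
  then show ?thesis
    by (simp add: block_upd_def[abs_def] axis_def[abs_def])
qed

lemma block_upd_self [simp]: "block_upd \<theta> k (\<theta> $ k) = \<theta>"
  by (simp add: block_upd_def vec_eq_iff)

lemma block_upd_zero: "block_upd 0 k v = axis k v"
  by (simp add: block_upd_def axis_def vec_eq_iff)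

lemma has_derivative_compose_block_upd:
  fixes \<theta> :: "'a::real_normed_vector ^ 'n::finite"
  assumes "(f has_derivative f') (at \<theta>)"
  shows "((\<lambda>t. f (block_upd \<theta> k t)) has_derivative (\<lambda>v. f' (axis k v))) (at (\<theta> $ k))"
  using has_derivative_compose[OF has_derivative_block_upd, of f f' \<theta> k "\<theta> $ k"] assms
  by simp

lemma gradient_eqI:
  assumes "GDERIV f x :> D"
  shows "gradient f x = D"
proof -
  have "E = D" if "GDERIV f x :> E" for E
  proof -
    have "(\<lambda>v. v \<bullet> E) = (\<lambda>v. v \<bullet> D)"
      using that assms unfolding gderiv_def by (rule has_derivative_unique)
    then show ?thesis
      by (metis inner_commute vector_eq_rdot)
  qed
  with assms show ?thesis
    unfolding gradient_def by blast
qed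

lemma GDERIV_block:
  fixes \<theta> :: "(real ^ 'k) ^ 'n::finite"
  assumes "GDERIV f \<theta> :> D"
  shows "has_block_gradient f i \<theta> (D $ i)"
  using has_derivative_compose_block_upd[OF assms[unfolded gderiv_def], of i]
  unfolding has_block_gradient_def gderiv_def by (simp add: inner_axis')

text \<open>
  Since this identifies the block gradient as a component of the full gradient, the block
  Jacobian can be read off from the derivative of the full gradient.
\<close>

lemma block_gradient_eqI:
  fixes \<theta> :: "(real ^ 'k) ^ 'n::finite"
  assumes "GDERIV f \<theta> :> D"
  shows "block_gradient f i \<theta> = D $ i"
  using GDERIV_block[OF assms] unfolding has_block_gradient_def block_gradient_def
  by (rule gradient_eqI)

text \<open>
  Along the segment from \<open>x\<close> to \<open>y\<close> the first and second derivatives of \<open>f\<close> are the gradient and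
  the Hessian form evaluated at \<open>y - x\<close>, which reduces concavity to the one-dimensional criterion.
\<close>

lemma concave_on_UNIV_if_hessian_nonpos:
  fixes f :: "'a::real_inner \<Rightarrow> real"
  assumes grad: "\<And>x. GDERIV f x :> g x"
    and hess: "\<And>x. (g has_derivative H x) (at x)"
    and nonpos: "\<And>x v. v \<bullet> H x v \<le> 0"
  shows "concave_on UNIV f"
  unfolding concave_on_iff
proof (intro conjI ballI allI impI convex_UNIV)
  fix x y :: 'a and u v :: real
  assume uv: "0 \<le> u" "0 \<le> v" "u + v = 1"
  define d where "d = y - x"
  define l where "l t = x + t *\<^sub>R d" for t
  have l: "(l has_derivative (\<lambda>s. s *\<^sub>R d)) (at t)" for t
    unfolding l_def by (auto intro!: derivative_eq_intros)
  have "concave_on UNIV (\<lambda>t. f (l t))"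
  proof (rule f''_le0_imp_concave)
    fix t
    show "((\<lambda>t. f (l t)) has_real_derivative d \<bullet> g (l t)) (at t)"
      using has_derivative_compose[OF l grad[unfolded gderiv_def]]
      by (simp add: has_field_derivative_def mult.commute[of _ "d \<bullet> _"])
    have lin: "linear (H (l t))"
      using hess has_derivative_linear by blast
    have "((\<lambda>t. d \<bullet> g (l t)) has_derivative (\<lambda>s. d \<bullet> H (l t) (s *\<^sub>R d))) (at t)"
      by (intro has_derivative_inner_right has_derivative_compose[OF l hess])
    then show "((\<lambda>t. d \<bullet> g (l t)) has_real_derivative d \<bullet> H (l t) d) (at t)"
      by (simp add: has_field_derivative_def linear_cmul[OF lin] mult.commute[of _ "d \<bullet> _"])
    show "d \<bullet> H (l t) d \<le> 0"
      by (rule nonpos)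
  qed simp
  then have "u * f (l 0) + v * f (l 1) \<le> f (l (u *\<^sub>R 0 + v *\<^sub>R 1))"
    using uv unfolding concave_on_iff by blast
  moreover have "l (u *\<^sub>R 0 + v *\<^sub>R 1) = u *\<^sub>R x + v *\<^sub>R y"
    using uv by (simp add: l_def d_def algebra_simps flip: scaleR_add_left)
  ultimately show "u * f x + v * f y \<le> f (u *\<^sub>R x + v *\<^sub>R y)"
    by (simp add: l_def d_def)
qed

section \<open>The soft assignment at one pixel\<close>

lemma exp_sum_pos: "0 < (\<Sum>j\<in>UNIV. exp (f (j::'n::finite)) :: real)"
  by (simp add: sum_pos)

lemma soft_assign_pos: "0 < soft_assign \<eta> \<epsilon> \<theta> (i::'n::finite) x"
  unfolding soft_assign_def by (intro divide_pos_pos exp_gt_zero exp_sum_pos)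

lemma sum_soft_assign: "(\<Sum>i\<in>UNIV. soft_assign \<eta> \<epsilon> \<theta> (i::'n::finite) x) = 1"
  unfolding soft_assign_def sum_divide_distrib[symmetric]
  by (rule divide_self) (rule less_imp_neq[symmetric], rule exp_sum_pos)

lemma ln_soft_assign:
  "ln (soft_assign \<eta> \<epsilon> \<theta> (i::'n::finite) x) =
     - (1 / \<epsilon>) * (\<theta> $ i \<bullet> \<eta> x) - ln (\<Sum>j\<in>UNIV. exp (- (1 / \<epsilon>) * (\<theta> $ j \<bullet> \<eta> x)))"
  unfolding soft_assign_def h_def by (simp only: ln_divide_pos[OF exp_gt_zero exp_sum_pos] ln_exp)

lemma sum_kronecker_diff:
  "(\<Sum>k\<in>UNIV. (kronecker i k - p k) * f k) = f (i::'n::finite) - (\<Sum>k\<in>UNIV. p k * f k)"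
  by (simp add: kronecker_def left_diff_distrib sum_subtractf if_distrib[of "\<lambda>c. c * _"]
      cong: if_cong)

text \<open>
  The logarithmic derivative of the partition function \<open>Z\<close> is the mean of the derivatives of the
  exponents, weighted by \<open>exp (-h\<^sub>j / \<epsilon>) / Z = p\<^sub>j\<close>.  By \<open>sum_kronecker_diff\<close> the sum against
  \<open>\<delta>\<^sub>i\<^sub>k - p\<^sub>k\<close> is the deviation of the \<open>i\<close>-th score from its mean.
\<close>

lemma has_derivative_ln_soft_assign:
  fixes \<theta> :: "(real ^ 'k::finite) ^ 'n::finite"
  shows "((\<lambda>\<theta>. ln (soft_assign \<eta> \<epsilon> \<theta> i x)) has_derivative
     (\<lambda>v. - (1 / \<epsilon>) * (\<Sum>k\<in>UNIV. (kronecker i k - soft_assign \<eta> \<epsilon> \<theta> k x) * (v $ k \<bullet> \<eta> x)))) (at \<theta>)"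
proof -
  define Z where "Z \<theta> = (\<Sum>j\<in>UNIV. exp (- (1 / \<epsilon>) * (\<theta> $ j \<bullet> \<eta> x)))"
    for \<theta> :: "(real ^ 'k) ^ 'n"
  have Z_pos: "0 < Z \<theta>"
    unfolding Z_def by (rule exp_sum_pos)
  have score: "((\<lambda>\<theta>. - (1 / \<epsilon>) * (\<theta> $ j \<bullet> \<eta> x)) has_derivative
      (\<lambda>v. - (1 / \<epsilon>) * (v $ j \<bullet> \<eta> x))) (at \<theta>)" for j
    by (intro has_derivative_mult_right has_derivative_inner_left
        bounded_linear_imp_has_derivative bounded_linear_vec_nth)
  have "(Z has_derivative (\<lambda>v. \<Sum>j\<in>UNIV.
      - (1 / \<epsilon>) * (v $ j \<bullet> \<eta> x) * exp (- (1 / \<epsilon>) * (\<theta> $ j \<bullet> \<eta> x)))) (at \<theta>)"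
    unfolding Z_def by (intro has_derivative_sum has_derivative_exp score)
  from has_derivative_diff[OF score[of i] has_derivative_ln[OF Z_pos this]]
  have "((\<lambda>\<theta>. ln (soft_assign \<eta> \<epsilon> \<theta> i x)) has_derivative (\<lambda>v. - (1 / \<epsilon>) * (v $ i \<bullet> \<eta> x) -
      (\<Sum>j\<in>UNIV. - (1 / \<epsilon>) * (v $ j \<bullet> \<eta> x) * exp (- (1 / \<epsilon>) * (\<theta> $ j \<bullet> \<eta> x)))
        * inverse (Z \<theta>))) (at \<theta>)"
    unfolding ln_soft_assign Z_def by simp
  moreover have "(\<Sum>j\<in>UNIV. - (1 / \<epsilon>) * (v $ j \<bullet> \<eta> x) * exp (- (1 / \<epsilon>) * (\<theta> $ j \<bullet> \<eta> x)))
        * inverse (Z \<theta>) =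
      - (1 / \<epsilon>) * (\<Sum>j\<in>UNIV. soft_assign \<eta> \<epsilon> \<theta> j x * (v $ j \<bullet> \<eta> x))" for v
    unfolding soft_assign_def h_def Z_def[symmetric] sum_distrib_left sum_distrib_right
    by (intro sum.cong refl) (simp add: divide_inverse)
  ultimately show ?thesis
    unfolding sum_kronecker_diff by (simp add: algebra_simps)
qed

text \<open>
  No quotient rule is needed: \<open>p\<^sub>i\<close> is positive, hence the exponential of its logarithm.
\<close>

lemma has_derivative_soft_assign:
  fixes \<theta> :: "(real ^ 'k::finite) ^ 'n::finite"
  shows "((\<lambda>\<theta>. soft_assign \<eta> \<epsilon> \<theta> i x) has_derivative
     (\<lambda>v. - (1 / \<epsilon>) * (soft_assign \<eta> \<epsilon> \<theta> i x *
       (\<Sum>k\<in>UNIV. (kronecker i k - soft_assign \<eta> \<epsilon> \<theta> k x) * (v $ k \<bullet> \<eta> x))))) (at \<theta>)"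
  using has_derivative_exp[OF has_derivative_ln_soft_assign[of \<eta> \<epsilon> i x \<theta>]]
  by (simp add: soft_assign_pos mult_ac)

section \<open>Covariance of scores under probability weights\<close>

text \<open>
  The matrix with entries \<open>p\<^sub>i (\<delta>\<^sub>i\<^sub>k - p\<^sub>k)\<close> is the covariance matrix of the indicators of the
  outcomes \<open>i\<close>; its bilinear form is the mean of a product minus the product of the means.
\<close>

lemma covariance_form:
  fixes p :: "'n::finite \<Rightarrow> real"
  shows "(\<Sum>i\<in>UNIV. p i * (\<Sum>k\<in>UNIV. (kronecker i k - p k) * b k) * a i) =
    (\<Sum>i\<in>UNIV. p i * (a i * b i)) - (\<Sum>i\<in>UNIV. p i * a i) * (\<Sum>i\<in>UNIV. p i * b i)"
proof -
  have "(\<Sum>i\<in>UNIV. p i * (b i - m) * a i) =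
      (\<Sum>i\<in>UNIV. p i * (a i * b i)) - (\<Sum>i\<in>UNIV. p i * a i) * m" for m
    by (simp add: algebra_simps sum_subtractf sum_distrib_left)
  then show ?thesis
    unfolding sum_kronecker_diff .
qed

text \<open>The variance is the mean of the squared deviations from the mean \<open>m\<close>.\<close>

lemma variance_form_nonneg:
  fixes p :: "'n::finite \<Rightarrow> real"
  assumes nonneg: "\<And>i. 0 \<le> p i" and total: "(\<Sum>i\<in>UNIV. p i) = 1"
  shows "0 \<le> (\<Sum>i\<in>UNIV. p i * (\<Sum>k\<in>UNIV. (kronecker i k - p k) * a k) * a i)"
proof -
  define m where "m = (\<Sum>i\<in>UNIV. p i * a i)"
  have "0 \<le> (\<Sum>i\<in>UNIV. p i * (a i - m)\<^sup>2)"
    by (intro sum_nonneg mult_nonneg_nonneg nonneg zero_le_power2)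
  also have "\<dots> = (\<Sum>i\<in>UNIV. p i * (a i * a i) - 2 * m * (p i * a i) + m\<^sup>2 * p i)"
    by (intro sum.cong refl) (simp add: power2_eq_square algebra_simps)
  also have "\<dots> = (\<Sum>i\<in>UNIV. p i * (a i * a i)) - 2 * m * (\<Sum>i\<in>UNIV. p i * a i)
      + m\<^sup>2 * (\<Sum>i\<in>UNIV. p i)"
    by (simp add: sum.distrib sum_subtractf sum_distrib_left)
  also have "\<dots> = (\<Sum>i\<in>UNIV. p i * (a i * a i)) - m * m"
    by (simp add: total power2_eq_square flip: m_def)
  finally show ?thesis
    unfolding covariance_form by (simp add: m_def)
qed

section \<open>Gradient and Hessian of the objective\<close>

definition objective_gradient ::
  "(real \<times> real) set \<Rightarrow> (real \<times> real \<Rightarrow> 'n) \<Rightarrow> (real \<times> real \<Rightarrow> real ^ 'k) \<Rightarrow> real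
     \<Rightarrow> (real ^ 'k) ^ 'n::finite \<Rightarrow> (real ^ 'k) ^ 'n" where
  "objective_gradient \<Omega> G \<eta> \<epsilon> \<theta> = (\<chi> i. - (1 / (\<epsilon> * real (card \<Omega>))) *\<^sub>R
     (\<Sum>x\<in>\<Omega>. (kronecker i (G x) - soft_assign \<eta> \<epsilon> \<theta> i x) *\<^sub>R \<eta> x))"

definition objective_hessian ::
  "(real \<times> real) set \<Rightarrow> (real \<times> real \<Rightarrow> real ^ 'k) \<Rightarrow> real
     \<Rightarrow> (real ^ 'k) ^ 'n::finite \<Rightarrow> (real ^ 'k) ^ 'n \<Rightarrow> (real ^ 'k) ^ 'n" where
  "objective_hessian \<Omega> \<eta> \<epsilon> \<theta> v = (\<chi> i. - (1 / (\<epsilon>\<^sup>2 * real (card \<Omega>))) *\<^sub>R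
     (\<Sum>x\<in>\<Omega>. (soft_assign \<eta> \<epsilon> \<theta> i x *
       (\<Sum>k\<in>UNIV. (kronecker i k - soft_assign \<eta> \<epsilon> \<theta> k x) * (v $ k \<bullet> \<eta> x))) *\<^sub>R \<eta> x))"

lemma kronecker_commute: "kronecker i j = kronecker j i"
  by (simp add: kronecker_def)

lemma GDERIV_objective:
  fixes \<theta> :: "(real ^ 'k::finite) ^ 'n::finite"
  shows "GDERIV (objective \<Omega> G \<eta> \<epsilon>) \<theta> :> objective_gradient \<Omega> G \<eta> \<epsilon> \<theta>"
proof -
  have "(objective \<Omega> G \<eta> \<epsilon> has_derivative (\<lambda>v. 1 / real (card \<Omega>) * (\<Sum>x\<in>\<Omega>. - (1 / \<epsilon>) *
      (\<Sum>k\<in>UNIV. (kronecker (G x) k - soft_assign \<eta> \<epsilon> \<theta> k x) * (v $ k \<bullet> \<eta> x))))) (at \<theta>)"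
    unfolding objective_def[abs_def]
    by (intro has_derivative_mult_right has_derivative_sum has_derivative_ln_soft_assign)
  moreover have "1 / real (card \<Omega>) * (\<Sum>x\<in>\<Omega>. - (1 / \<epsilon>) *
      (\<Sum>k\<in>UNIV. (kronecker (G x) k - soft_assign \<eta> \<epsilon> \<theta> k x) * (v $ k \<bullet> \<eta> x))) =
      v \<bullet> objective_gradient \<Omega> G \<eta> \<epsilon> \<theta>" for v
    unfolding inner_vec_def[of v] objective_gradient_def
    by (simp add: inner_sum_right sum_distrib_left sum.swap[of _ UNIV \<Omega>]
        kronecker_commute[of _ "G _"] mult_ac sum_negf)
  ultimately show ?thesis
    unfolding gderiv_def by simp
qed

lemma has_derivative_objective_gradient:
  fixes \<theta> :: "(real ^ 'k::finite) ^ 'n::finite"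
  shows "(objective_gradient \<Omega> G \<eta> \<epsilon> has_derivative objective_hessian \<Omega> \<eta> \<epsilon> \<theta>) (at \<theta>)"
  unfolding objective_gradient_def[abs_def] objective_hessian_def[abs_def]
proof (rule has_derivative_vec_lambda)
  fix i
  let ?D = "\<lambda>v x. soft_assign \<eta> \<epsilon> \<theta> i x *
    (\<Sum>k\<in>UNIV. (kronecker i k - soft_assign \<eta> \<epsilon> \<theta> k x) * (v $ k \<bullet> \<eta> x))"
  have "((\<lambda>\<theta>. - (1 / (\<epsilon> * real (card \<Omega>))) *\<^sub>R
      (\<Sum>x\<in>\<Omega>. (kronecker i (G x) - soft_assign \<eta> \<epsilon> \<theta> i x) *\<^sub>R \<eta> x)) has_derivative
    (\<lambda>v. - (1 / (\<epsilon> * real (card \<Omega>))) *\<^sub>R (\<Sum>x\<in>\<Omega>. (0 - - (1 / \<epsilon>) * ?D v x) *\<^sub>R \<eta> x))) (at \<theta>)"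
    by (intro has_derivative_scaleR_right has_derivative_sum has_derivative_scaleR_left
        has_derivative_diff has_derivative_const has_derivative_soft_assign)
  moreover have "- (1 / (\<epsilon> * real (card \<Omega>))) *\<^sub>R (\<Sum>x\<in>\<Omega>. (0 - - (1 / \<epsilon>) * ?D v x) *\<^sub>R \<eta> x) =
      - (1 / (\<epsilon>\<^sup>2 * real (card \<Omega>))) *\<^sub>R (\<Sum>x\<in>\<Omega>. ?D v x *\<^sub>R \<eta> x)" for v
    by (simp add: scaleR_sum_right power2_eq_square mult_ac)
  ultimately show "((\<lambda>\<theta>. - (1 / (\<epsilon> * real (card \<Omega>))) *\<^sub>R
      (\<Sum>x\<in>\<Omega>. (kronecker i (G x) - soft_assign \<eta> \<epsilon> \<theta> i x) *\<^sub>R \<eta> x)) has_derivative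
    (\<lambda>v. - (1 / (\<epsilon>\<^sup>2 * real (card \<Omega>))) *\<^sub>R (\<Sum>x\<in>\<Omega>. ?D v x *\<^sub>R \<eta> x))) (at \<theta>)"
    by simp
qed

lemma gradient_objective: "gradient (objective \<Omega> G \<eta> \<epsilon>) = objective_gradient \<Omega> G \<eta> \<epsilon>"
  by (intro ext gradient_eqI GDERIV_objective)

lemma hessian_objective: "hessian (objective \<Omega> G \<eta> \<epsilon>) \<theta> = objective_hessian \<Omega> \<eta> \<epsilon> \<theta>"
  unfolding hessian_def gradient_objective
  by (rule frechet_derivative_at[symmetric]) (rule has_derivative_objective_gradient)

lemma twice_differentiable_objective: "twice_differentiable_at (objective \<Omega> G \<eta> \<epsilon>) \<theta>"
  using GDERIV_objective[of \<Omega> G \<eta> \<epsilon>] has_derivative_objective_gradient[of \<Omega> G \<eta> \<epsilon>]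
  unfolding twice_differentiable_at_def gradient_objective differentiable_def gderiv_def
  by (auto intro!: always_eventually)

lemma outer_mult_vector: "outer u w *v v = (w \<bullet> v) *\<^sub>R u"
  by (simp add: outer_def matrix_vector_mult_def inner_vec_def vec_eq_iff sum_distrib_left
      sum_distrib_right mult_ac)

lemma sum_matrix_vector_mult:
  fixes A :: "'x \<Rightarrow> real ^ 'k::finite ^ 'l"
  shows "(\<Sum>x\<in>S. A x) *v v = (\<Sum>x\<in>S. A x *v v)"
  by (induction S rule: infinite_finite_induct) (auto simp: matrix_vector_mult_add_rdistrib)

lemma objective_hessian_axis:
  fixes \<theta> :: "(real ^ 'k::finite) ^ 'n::finite"
  shows "objective_hessian \<Omega> \<eta> \<epsilon> \<theta> (axis k v) $ i =
     (- (1 / (\<epsilon>\<^sup>2 * real (card \<Omega>))) *\<^sub>R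
       (\<Sum>x\<in>\<Omega>. (soft_assign \<eta> \<epsilon> \<theta> i x * (kronecker i k - soft_assign \<eta> \<epsilon> \<theta> k x))
          *\<^sub>R outer (\<eta> x) (\<eta> x))) *v v"
proof -
  have "(\<Sum>j\<in>UNIV. c j * ((axis k v :: (real ^ 'k) ^ 'n) $ j \<bullet> w)) = c k * (w \<bullet> v)" for c w
    by (simp add: axis_def inner_commute[of w] if_distrib[of "\<lambda>u. u \<bullet> _"]
        if_distrib[of "\<lambda>r. _ * r"] cong: if_cong)
  then show ?thesis
    unfolding objective_hessian_def
    by (simp only: vec_lambda_beta scaleR_matrix_vector_assoc[symmetric] sum_matrix_vector_mult
        outer_mult_vector scaleR_scaleR mult.assoc)
qed

lemma inner_objective_hessian:
  "u \<bullet> objective_hessian \<Omega> \<eta> \<epsilon> \<theta> v = - (1 / (\<epsilon>\<^sup>2 * real (card \<Omega>))) *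
     (\<Sum>x\<in>\<Omega>. \<Sum>i\<in>UNIV. soft_assign \<eta> \<epsilon> \<theta> i x *
       (\<Sum>k\<in>UNIV. (kronecker i k - soft_assign \<eta> \<epsilon> \<theta> k x) * (v $ k \<bullet> \<eta> x)) * (u $ i \<bullet> \<eta> x))"
  unfolding inner_vec_def[of u] objective_hessian_def
  by (simp add: inner_sum_right sum_distrib_left sum.swap[of _ UNIV \<Omega>] sum_negf)

lemma objective_hessian_symmetric:
  "objective_hessian \<Omega> \<eta> \<epsilon> \<theta> u \<bullet> v = u \<bullet> objective_hessian \<Omega> \<eta> \<epsilon> \<theta> v"
  unfolding inner_commute[of _ v] inner_objective_hessian covariance_form
  by (simp add: mult.commute)

lemma objective_hessian_nonpos: "v \<bullet> objective_hessian \<Omega> \<eta> \<epsilon> \<theta> v \<le> 0"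
  unfolding inner_objective_hessian
  by (intro mult_nonpos_nonneg sum_nonneg variance_form_nonneg)
    (auto simp: sum_soft_assign intro: less_imp_le soft_assign_pos)

lemma negative_semidefinite_objective_hessian:
  "negative_semidefinite (objective_hessian \<Omega> \<eta> \<epsilon> \<theta>)"
  unfolding negative_semidefinite_def
  using has_derivative_linear[OF has_derivative_objective_gradient]
  by (blast intro: objective_hessian_symmetric objective_hessian_nonpos)

lemma objective_hessian_const: "objective_hessian \<Omega> \<eta> \<epsilon> \<theta> (\<chi> j. c) = 0"
  unfolding objective_hessian_def sum_kronecker_diff
  by (simp add: vec_eq_iff sum_soft_assign flip: sum_distrib_right)

section \<open>Concavity and the derivative formulas\<close>

theorem proposition4p4:
  fixes \<Omega> :: "(real \<times> real) set"
    and G :: "real \<times> real \<Rightarrow> 'n::finite"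
    and \<eta> :: "real \<times> real \<Rightarrow> real ^ 'k::finite"
    and \<epsilon> :: real
  assumes "\<Omega> \<subseteq> Omega_bar" and "finite \<Omega>" and "\<Omega> \<noteq> {}"
    and "CARD('n) > 1"
    and "\<epsilon> > 0"
  shows "(concave_on UNIV (objective \<Omega> G \<eta> \<epsilon>)) \<and>
    (\<forall>i \<theta>. has_block_gradient (objective \<Omega> G \<eta> \<epsilon>) i \<theta>
           (- (1 / (\<epsilon> * real (card \<Omega>))) *\<^sub>R
              (\<Sum>x\<in>\<Omega>. (kronecker i (G x) - soft_assign \<eta> \<epsilon> \<theta> i x) *\<^sub>R \<eta> x))) \<and>
    (\<forall>i k \<theta>. has_block_jacobian (block_gradient (objective \<Omega> G \<eta> \<epsilon>) i) k \<theta>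
           (- (1 / (\<epsilon>\<^sup>2 * real (card \<Omega>))) *\<^sub>R
              (\<Sum>x\<in>\<Omega>. (soft_assign \<eta> \<epsilon> \<theta> i x * (kronecker i k - soft_assign \<eta> \<epsilon> \<theta> k x))
                 *\<^sub>R outer (\<eta> x) (\<eta> x)))) \<and>
    (\<forall>\<theta>. twice_differentiable_at (objective \<Omega> G \<eta> \<epsilon>) \<theta>) \<and>
    (\<forall>i k \<theta>. operator_block (hessian (objective \<Omega> G \<eta> \<epsilon>) \<theta>) i k =
           - (1 / (\<epsilon>\<^sup>2 * real (card \<Omega>))) *\<^sub>R
              (\<Sum>x\<in>\<Omega>. (soft_assign \<eta> \<epsilon> \<theta> i x * (kronecker i k - soft_assign \<eta> \<epsilon> \<theta> k x))
                 *\<^sub>R outer (\<eta> x) (\<eta> x))) \<and>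
    (\<forall>\<theta>. negative_semidefinite (hessian (objective \<Omega> G \<eta> \<epsilon>) \<theta>)) \<and>
    (\<forall>\<theta> c. hessian (objective \<Omega> G \<eta> \<epsilon>) \<theta> (\<chi> j. c) = 0)"
proof (intro conjI allI)
  show "concave_on UNIV (objective \<Omega> G \<eta> \<epsilon>)"
    using GDERIV_objective has_derivative_objective_gradient objective_hessian_nonpos
    by (rule concave_on_UNIV_if_hessian_nonpos)
next
  fix i \<theta>
  show "has_block_gradient (objective \<Omega> G \<eta> \<epsilon>) i \<theta>
      (- (1 / (\<epsilon> * real (card \<Omega>))) *\<^sub>R
        (\<Sum>x\<in>\<Omega>. (kronecker i (G x) - soft_assign \<eta> \<epsilon> \<theta> i x) *\<^sub>R \<eta> x))"
    using GDERIV_block[OF GDERIV_objective, where i = i]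
    by (simp add: objective_gradient_def)
next
  fix i k \<theta>
  have block: "block_gradient (objective \<Omega> G \<eta> \<epsilon>) i = (\<lambda>\<theta>. objective_gradient \<Omega> G \<eta> \<epsilon> \<theta> $ i)"
    by (intro ext block_gradient_eqI GDERIV_objective)
  have "((\<lambda>\<theta>. objective_gradient \<Omega> G \<eta> \<epsilon> \<theta> $ i) has_derivative
      (\<lambda>v. objective_hessian \<Omega> \<eta> \<epsilon> \<theta> v $ i)) (at \<theta>)"
    by (rule bounded_linear.has_derivative[OF bounded_linear_vec_nth
          has_derivative_objective_gradient])
  from has_derivative_compose_block_upd[OF this] show "has_block_jacobian (block_gradient (objective \<Omega> G \<eta> \<epsilon>) i) k \<theta>
      (- (1 / (\<epsilon>\<^sup>2 * real (card \<Omega>))) *\<^sub>R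
        (\<Sum>x\<in>\<Omega>. (soft_assign \<eta> \<epsilon> \<theta> i x * (kronecker i k - soft_assign \<eta> \<epsilon> \<theta> k x))
           *\<^sub>R outer (\<eta> x) (\<eta> x)))"
    unfolding has_block_jacobian_def objective_hessian_axis[symmetric] block .
next
  fix \<theta>
  show "twice_differentiable_at (objective \<Omega> G \<eta> \<epsilon>) \<theta>"
    by (rule twice_differentiable_objective)
next
  fix i k \<theta>
  show "operator_block (hessian (objective \<Omega> G \<eta> \<epsilon>) \<theta>) i k =
      - (1 / (\<epsilon>\<^sup>2 * real (card \<Omega>))) *\<^sub>R
        (\<Sum>x\<in>\<Omega>. (soft_assign \<eta> \<epsilon> \<theta> i x * (kronecker i k - soft_assign \<eta> \<epsilon> \<theta> k x))
           *\<^sub>R outer (\<eta> x) (\<eta> x))"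
    unfolding operator_block_def hessian_objective block_upd_zero objective_hessian_axis
    by (rule matrix_of_matrix_vector_mul)
next
  fix \<theta>
  show "negative_semidefinite (hessian (objective \<Omega> G \<eta> \<epsilon>) \<theta>)"
    unfolding hessian_objective by (rule negative_semidefinite_objective_hessian)
next
  fix \<theta> c
  show "hessian (objective \<Omega> G \<eta> \<epsilon>) \<theta> (\<chi> j. c) = 0"
    unfolding hessian_objective by (rule objective_hessian_const)
qed

end
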